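(* Let $A$ and $B$ be nonempty subsets of a metric space $(X,d)$ endowed with a graph $G$, and let $T:A\cup B\to A\cup B$ be a G-ciric-Rich-Rus-Moh operator. If some $x\in A\cup B$ satisfies $(x,Tx)\in E(G)$, then the pair $(A,B)$ is a $G$-approximate best proximity pair, i.e. for every given $\epsilon>0$, $P^{Ga}_{T}(A,B)\neq\emptyset$.
   Context: Throughout, $G$ is a directed graph without parallel edges with vertex set $V(G)=X$ (so $E(G)\subseteq X\times X$), and $E(G)$ contains the diagonal $\{(x,x):x\in X\}$. $d(A,B)=\inf\{d(a,b):a\in A,\ b\in B\}$. A map $T:A\cup B\to A\cup B$ satisfying $T(A)\subseteq B$ and $T(B)\subseteq A$ is a G-ciric-Rich-Rus-Moh operator if: (i) for all $x,y\in A\cup B$, $(x,y)\in E(G)$ implies $(Tx,Ty)\in E(G)$; (ii) there exist nonnegative numbers $\alpha,\beta,\gamma$ with $\alpha+2\beta+\gamma<1$ such that, for all $x,y\in A\cup B$ with $(x,y)\in E(G)$, $d(Tx,Ty)\le \alpha d(x,y)+\beta[d(x,Tx)+d(y,Ty)]+\gamma d(A,B)$. For a given $\epsilon>0$, $P^{Ga}_{T}(A,B)=\{x\in A\cup B:\ (x,Tx)\in E(G)\Rightarrow d(x,Tx)\le d(A,B)+\epsilon\}$. The pair $(A,B)$ is called a $G$-approximate best proximity pair if $P^{Ga}_{T}(A,B)\ne\emptyset$. *)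

theory Defs
  imports "HOL-Analysis.Analysis" "Graph_Theory.Pair_Digraph"
begin

text \<open>
  The metric space \<open>X\<close> is the universe of a type of class \<^class>\<open>metric_space\<close>, and
  \<open>d(A,B)\<close> is \<^const>\<open>setdist\<close>, which is the infimum of the pairwise distances whenever
  \<open>A\<close> and \<open>B\<close> are nonempty.  The graph need not be finite, and \<open>E(G)\<close> is \<^const>\<open>parcs\<close>.
\<close>

definition metric_graph :: "'a::metric_space pair_pre_digraph \<Rightarrow> bool" where
  "metric_graph G \<longleftrightarrow> pair_wf_digraph G \<and> pverts G = UNIV \<and> Id \<subseteq> parcs G"

text \<open>
  A map \<open>A \<union> B \<rightarrow> A \<union> B\<close> is a total function of which only the values on \<open>A \<union> B\<close> are
  used; that it maps \<open>A \<union> B\<close> into itself follows from the two image conditions.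
\<close>

definition G_ciric_Rich_Rus_Moh ::
  "'a::metric_space pair_pre_digraph \<Rightarrow> 'a set \<Rightarrow> 'a set \<Rightarrow> ('a \<Rightarrow> 'a) \<Rightarrow> bool" where
  "G_ciric_Rich_Rus_Moh G A B T \<longleftrightarrow>
     T ` A \<subseteq> B \<and> T ` B \<subseteq> A \<and>
     (\<forall>x \<in> A \<union> B. \<forall>y \<in> A \<union> B. (x, y) \<in> parcs G \<longrightarrow> (T x, T y) \<in> parcs G) \<and>
     (\<exists>\<alpha> \<beta> \<gamma> :: real. \<alpha> \<ge> 0 \<and> \<beta> \<ge> 0 \<and> \<gamma> \<ge> 0 \<and> \<alpha> + 2 * \<beta> + \<gamma> < 1 \<and>
        (\<forall>x \<in> A \<union> B. \<forall>y \<in> A \<union> B. (x, y) \<in> parcs G \<longrightarrow>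
           dist (T x) (T y) \<le>
             \<alpha> * dist x y + \<beta> * (dist x (T x) + dist y (T y)) + \<gamma> * setdist A B))"

text \<open>
  Membership is an implication: points with \<open>(x, T x)\<close> not an edge belong to the set.
\<close>

definition G_approx_best_prox_points ::
  "'a::metric_space pair_pre_digraph \<Rightarrow> 'a set \<Rightarrow> 'a set \<Rightarrow> ('a \<Rightarrow> 'a) \<Rightarrow> real \<Rightarrow> 'a set" where
  "G_approx_best_prox_points G A B T \<epsilon> =
     {x \<in> A \<union> B. (x, T x) \<in> parcs G \<longrightarrow> dist x (T x) \<le> setdist A B + \<epsilon>}"

definition G_approx_best_prox_pair ::
  "'a::metric_space pair_pre_digraph \<Rightarrow> 'a set \<Rightarrow> 'a set \<Rightarrow> ('a \<Rightarrow> 'a) \<Rightarrow> bool" where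
  "G_approx_best_prox_pair G A B T \<longleftrightarrow>
     (\<forall>\<epsilon>>0. G_approx_best_prox_points G A B T \<epsilon> \<noteq> {})"

end

theory Submission
  imports Defs
begin

text \<open>
  Write \<open>D = d(A,B)\<close>.  Along the orbit of a point \<open>x\<close> joined to its own image, every
  consecutive pair \<open>(T\<^sup>n x, T\<^sup>n\<^sup>+\<^sup>1 x)\<close> is again an edge, so the contractive
  inequality applies at each stage.  Since \<open>\<alpha> + 2\<beta> + \<gamma> < 1\<close> and \<open>D \<ge> 0\<close>, that
  inequality says that the excess \<open>d(y, T y) - D\<close> shrinks at least by the fixed factor
  \<open>k = (\<alpha> + \<beta>) / (1 - \<beta>) < 1\<close> when \<open>y\<close> is replaced by \<open>T y\<close>
  (lemma \<open>excess_contracts\<close>).  Hence the excess at \<open>T\<^sup>n x\<close> is at most \<open>k\<^sup>n\<close> times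
  the excess at \<open>x\<close> (lemma \<open>excess_iterate\<close>), and for every \<open>\<epsilon> > 0\<close> some iterate of
  \<open>x\<close> is an \<open>\<epsilon>\<close>-approximate best proximity point.
\<close>

text \<open>
  Taking \<open>y = T x\<close> in the contractive condition puts \<open>d(T x, T (T x))\<close> on both sides;
  solving for it gives \<open>(1 - \<beta>) d(T x, T (T x)) \<le> (\<alpha> + \<beta>) d(x, T x) + \<gamma> D\<close>.  Subtracting
  \<open>(1 - \<beta>) D\<close> turns this into the homogeneous estimate for the excess over \<open>D\<close>, because
  \<open>\<gamma> \<le> (1 - \<beta>) - (\<alpha> + \<beta>)\<close>.
\<close>

lemma excess_contracts:
  assumes "G_ciric_Rich_Rus_Moh G A B T"
  obtains k :: real where "0 \<le> k" "k < 1"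
    and "\<And>x. x \<in> A \<union> B \<Longrightarrow> (x, T x) \<in> parcs G \<Longrightarrow>
           dist (T x) (T (T x)) - setdist A B \<le> k * (dist x (T x) - setdist A B)"
proof -
  let ?D = "setdist A B"
  obtain \<alpha> \<beta> \<gamma> :: real where nonneg: "\<alpha> \<ge> 0" "\<beta> \<ge> 0" "\<gamma> \<ge> 0"
    and small: "\<alpha> + 2 * \<beta> + \<gamma> < 1"
    and contr: "\<And>x y. x \<in> A \<union> B \<Longrightarrow> y \<in> A \<union> B \<Longrightarrow> (x, y) \<in> parcs G \<Longrightarrow>
      dist (T x) (T y) \<le> \<alpha> * dist x y + \<beta> * (dist x (T x) + dist y (T y)) + \<gamma> * ?D"
    using assms unfolding G_ciric_Rich_Rus_Moh_def by blast
  have pos: "0 < 1 - \<beta>"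
    using nonneg small by linarith
  show thesis
  proof (rule that [of "(\<alpha> + \<beta>) / (1 - \<beta>)"])
    show "0 \<le> (\<alpha> + \<beta>) / (1 - \<beta>)"
      using nonneg pos by simp
    show "(\<alpha> + \<beta>) / (1 - \<beta>) < 1"
      using nonneg small pos by (simp add: divide_less_eq)
  next
    fix x assume x: "x \<in> A \<union> B" and edge: "(x, T x) \<in> parcs G"
    have Tx: "T x \<in> A \<union> B"
      using assms x unfolding G_ciric_Rich_Rus_Moh_def by blast
    have "\<gamma> * ?D \<le> (1 - \<alpha> - 2 * \<beta>) * ?D"
      using small by (intro mult_right_mono) auto
    with contr [OF x Tx edge]
    have "(dist (T x) (T (T x)) - ?D) * (1 - \<beta>) \<le> (\<alpha> + \<beta>) * (dist x (T x) - ?D)"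
      by (simp add: algebra_simps)
    then show "dist (T x) (T (T x)) - ?D \<le> (\<alpha> + \<beta>) / (1 - \<beta>) * (dist x (T x) - ?D)"
      using pos by (simp add: pos_le_divide_eq)
  qed
qed

lemma orbit_edge:
  assumes "G_ciric_Rich_Rus_Moh G A B T"
    and "x \<in> A \<union> B" and "(x, T x) \<in> parcs G"
  shows "(T ^^ n) x \<in> A \<union> B \<and> ((T ^^ n) x, T ((T ^^ n) x)) \<in> parcs G"
proof (induction n)
  case 0
  show ?case using assms by simp
next
  case (Suc n)
  let ?y = "(T ^^ n) x"
  have "T ?y \<in> A \<union> B"
    using Suc assms(1) unfolding G_ciric_Rich_Rus_Moh_def by blast
  moreover have "(T ?y, T (T ?y)) \<in> parcs G"
    using Suc \<open>T ?y \<in> A \<union> B\<close> assms(1) unfolding G_ciric_Rich_Rus_Moh_def by blast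
  ultimately show ?case by simp
qed

lemma excess_iterate:
  assumes T: "G_ciric_Rich_Rus_Moh G A B T"
    and x: "x \<in> A \<union> B" and edge: "(x, T x) \<in> parcs G"
  obtains k :: real where "0 \<le> k" "k < 1"
    and "\<And>n. dist ((T ^^ n) x) (T ((T ^^ n) x)) - setdist A B
           \<le> k ^ n * (dist x (T x) - setdist A B)"
proof -
  obtain k :: real where k: "0 \<le> k" "k < 1"
    and contr: "\<And>y. y \<in> A \<union> B \<Longrightarrow> (y, T y) \<in> parcs G \<Longrightarrow>
      dist (T y) (T (T y)) - setdist A B \<le> k * (dist y (T y) - setdist A B)"
    using excess_contracts [OF T] by blast
  have "dist ((T ^^ n) x) (T ((T ^^ n) x)) - setdist A B
          \<le> k ^ n * (dist x (T x) - setdist A B)" for n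
  proof (induction n)
    case 0
    show ?case by simp
  next
    case (Suc n)
    let ?y = "(T ^^ n) x"
    have "dist (T ?y) (T (T ?y)) - setdist A B \<le> k * (dist ?y (T ?y) - setdist A B)"
      using contr orbit_edge [OF T x edge] by blast
    also have "\<dots> \<le> k * (k ^ n * (dist x (T x) - setdist A B))"
      using Suc k(1) by (rule mult_left_mono)
    finally show ?case by (simp add: mult.assoc)
  qed
  with k show thesis by (rule that)
qed

theorem theorem3p6:
  fixes G :: "'a::metric_space pair_pre_digraph"
    and A B :: "'a set" and T :: "'a \<Rightarrow> 'a"
  assumes "metric_graph G"
    and "A \<noteq> {}" and "B \<noteq> {}"
    and "G_ciric_Rich_Rus_Moh G A B T"
    and "\<exists>x \<in> A \<union> B. (x, T x) \<in> parcs G"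
  shows "G_approx_best_prox_pair G A B T"
  unfolding G_approx_best_prox_pair_def
proof (intro allI impI)
  fix \<epsilon> :: real assume "\<epsilon> > 0"
  obtain x where x: "x \<in> A \<union> B" and edge: "(x, T x) \<in> parcs G"
    using assms(5) by blast
  let ?e = "dist x (T x) - setdist A B"
  obtain k :: real where k: "0 \<le> k" "k < 1"
    and bound: "\<And>n. dist ((T ^^ n) x) (T ((T ^^ n) x)) - setdist A B \<le> k ^ n * ?e"
    using excess_iterate [OF assms(4) x edge] by blast
  have "(\<lambda>n. k ^ n * ?e) \<longlonglongrightarrow> 0"
    using k by (intro tendsto_mult_left_zero LIMSEQ_power_zero) simp
  then have "\<forall>\<^sub>F n in sequentially. k ^ n * ?e < \<epsilon>"
    using \<open>\<epsilon> > 0\<close> by (rule order_tendstoD(2))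
  then obtain n where "k ^ n * ?e < \<epsilon>"
    by (auto simp: eventually_sequentially)
  with bound [of n]
  have "dist ((T ^^ n) x) (T ((T ^^ n) x)) \<le> setdist A B + \<epsilon>"
    by linarith
  with orbit_edge [OF assms(4) x edge, of n]
  have "(T ^^ n) x \<in> G_approx_best_prox_points G A B T \<epsilon>"
    unfolding G_approx_best_prox_points_def by simp
  then show "G_approx_best_prox_points G A B T \<epsilon> \<noteq> {}"
    by blast
qed

end
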